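(* Let $V:\mathbb{R}^{n_x}\to\mathbb{R}_{\ge 0}$ be continuously differentiable, where the state is split as $x=\begin{bmatrix} x^{\mathrm{obs}}\\ x^{\mathrm{lat}}\end{bmatrix}\in\mathbb{R}^{n_x}$ with $x^{\mathrm{lat}}\in\mathbb{R}^{n_{\mathrm{lat}}}$, and let $u\in\mathbb{R}^{n_u}$ denote the input. Suppose that $r_\phi:\mathbb{R}^{n_x}\times\mathbb{R}^{n_u}\to\mathbb{R}^{n_{\mathrm{lat}}}$ has the form $$r_\phi(x,u)=\big(S_\phi(x,u)-K_\phi(x,u)\big)\,\nabla_{x^{\mathrm{lat}}}V(x),$$ where, for every $(x,u)$, $S_\phi(x,u)\in\mathbb{R}^{n_{\mathrm{lat}}\times n_{\mathrm{lat}}}$ is skew-symmetric ($S_\phi(x,u)^\top=-S_\phi(x,u)$) and $K_\phi(x,u)\in\mathbb{R}^{n_{\mathrm{lat}}\times n_{\mathrm{lat}}}$ is positive semidefinite ($K_\phi(x,u)\succeq 0$). Then $$\nabla_{x^{\mathrm{lat}}}V(x)^\top r_\phi(x,u)\le 0\qquad\text{for all }(x,u)\in\mathbb{R}^{n_x}\times\mathbb{R}^{n_u}.$$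
   Context: The state $x\in\mathbb{R}^{n_x}$ consists of a measured part $x^{\mathrm{obs}}$ and a latent (unmeasured) part $x^{\mathrm{lat}}\in\mathbb{R}^{n_{\mathrm{lat}}}$. $\nabla_{x^{\mathrm{lat}}}V(x)\in\mathbb{R}^{n_{\mathrm{lat}}}$ is the vector of partial derivatives of $V$ with respect to the components of $x^{\mathrm{lat}}$, evaluated at the full state $x$. $K\succeq 0$ means $K$ is a real symmetric positive semidefinite matrix. The subscript $\phi$ denotes an arbitrary fixed parameter vector (neural network parameters), and plays no role beyond indexing the functions. *)

theory Defs
  imports "HOL-Analysis.Analysis"
begin

definition continuously_differentiable :: "('a::real_inner \<Rightarrow> real) \<Rightarrow> bool" where
  "continuously_differentiable V \<longleftrightarrow>
     (\<exists>G. (\<forall>x. GDERIV V x :> G x) \<and> continuous_on UNIV G)"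

definition partial_deriv :: "(real ^ 'n \<Rightarrow> real) \<Rightarrow> 'n::finite \<Rightarrow> real ^ 'n \<Rightarrow> real" where
  "partial_deriv V j x = deriv (\<lambda>t. V (x + t *\<^sub>R axis j 1)) 0"

(* The state is the block vector x = [x_obs; x_lat], indexed by the disjoint sum 'obs + 'lat:
   x $ Inl i is the i-th observed and x $ Inr i the i-th latent component. *)

definition grad_lat ::
  "(real ^ ('obs::finite + 'lat::finite) \<Rightarrow> real) \<Rightarrow> real ^ ('obs + 'lat) \<Rightarrow> real ^ 'lat" where
  "grad_lat V x = (\<chi> i. partial_deriv V (Inr i) x)"

definition skew_symmetric :: "real ^ 'n ^ 'n \<Rightarrow> bool" where
  "skew_symmetric S \<longleftrightarrow> transpose S = - S"

definition pos_semidef :: "real ^ 'n::finite ^ 'n \<Rightarrow> bool" where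
  "pos_semidef K \<longleftrightarrow> transpose K = K \<and> (\<forall>v. 0 \<le> v \<bullet> (K *v v))"

(* deriv is a choice operator; where V has a gradient, partial_deriv is its j-th component. *)
lemma partial_deriv_eq_gradient_component:
  assumes "GDERIV V x :> g"
  shows "partial_deriv V j x = g $ j"
proof -
  have V: "(V has_derivative (\<lambda>h. h \<bullet> g)) (at (x + 0 *\<^sub>R axis j 1))"
    using assms by (simp add: gderiv_def)
  have "((\<lambda>t. V (x + t *\<^sub>R axis j 1)) has_derivative (\<lambda>t. (t *\<^sub>R axis j 1) \<bullet> g)) (at 0)"
    by (rule has_derivative_compose[where f = "\<lambda>t. x + t *\<^sub>R axis j 1" and g = V, OF _ V])
      (auto intro!: derivative_eq_intros)
  then have "((\<lambda>t. V (x + t *\<^sub>R axis j 1)) has_field_derivative g $ j) (at 0)"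
    by (simp add: has_field_derivative_def inner_axis' mult_commute_abs)
  then show ?thesis
    unfolding partial_deriv_def by (rule DERIV_imp_deriv)
qed

end

theory Submission
  imports Defs
begin

text \<open>Write g for the latent gradient at x. By linearity, g . r is the quadratic form of S at
  g minus that of K at g. The first vanishes because S is skew
  (\<open>skew_symmetric_quadratic_form_eq_0\<close>), the second is nonnegative because K is
  positive semidefinite. Thus S is the conservative and K the dissipative part.\<close>

lemma skew_symmetric_quadratic_form_eq_0:
  fixes S :: "real ^ 'n::finite ^ 'n"
  assumes "skew_symmetric S"
  shows "v \<bullet> (S *v v) = 0"
proof -
  have "v \<bullet> (S *v v) = (transpose S *v v) \<bullet> v"
    by (simp add: dot_lmul_matrix)
  \<comment> \<open>The form equals its own negative, hence is 0 over the reals. Reading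
    \<open>- S\<close> as \<open>0 - S\<close> lets distributivity over differences pull out the
    sign.\<close>
  also have "\<dots> = - (v \<bullet> (S *v v))"
    using assms unfolding skew_symmetric_def
    by (metis diff_0 inner_commute inner_minus_left matrix_vector_mult_0 matrix_vector_mult_diff_rdistrib)
  finally show ?thesis by simp
qed

theorem proposition1:
  fixes V :: "real ^ ('obs::finite + 'lat::finite) \<Rightarrow> real"
    and \<phi> :: "real ^ 'p::finite"
    and r :: "real ^ 'p \<Rightarrow> real ^ ('obs + 'lat) \<Rightarrow> real ^ 'u::finite \<Rightarrow> real ^ 'lat"
    and S K :: "real ^ 'p \<Rightarrow> real ^ ('obs + 'lat) \<Rightarrow> real ^ 'u \<Rightarrow> real ^ 'lat ^ 'lat"
  assumes "\<And>x. V x \<ge> 0"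
    and "continuously_differentiable V"
    and "\<And>x u. r \<phi> x u = (S \<phi> x u - K \<phi> x u) *v grad_lat V x"
    and "\<And>x u. skew_symmetric (S \<phi> x u)"
    and "\<And>x u. pos_semidef (K \<phi> x u)"
  shows "\<forall>x u. grad_lat V x \<bullet> r \<phi> x u \<le> 0"
proof (intro allI)
  fix x u
  let ?g = "grad_lat V x"
  have "?g \<bullet> r \<phi> x u = ?g \<bullet> (S \<phi> x u *v ?g) - ?g \<bullet> (K \<phi> x u *v ?g)"
    by (simp add: assms(3) matrix_vector_mult_diff_rdistrib inner_diff_right)
  also have "\<dots> = - (?g \<bullet> (K \<phi> x u *v ?g))"
    using assms(4) by (simp add: skew_symmetric_quadratic_form_eq_0)
  \<comment> \<open>The only inequality: semidefiniteness tested at the vector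
    \<open>?g\<close>.\<close>
  also have "\<dots> \<le> 0"
    using assms(5) by (simp add: pos_semidef_def)
  finally show "?g \<bullet> r \<phi> x u \<le> 0" .
qed

end
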